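(* The Cotangent Lift (CT), PSD Complex SVD (cSVD) and the greedy procedure for symplectic basis generation (as specified in the context) all produce a symplectic, orthonormal matrix. The non-linear programming (NLP) procedure produces a symplectic, orthonormal matrix if its coefficient matrix $C$ is symplectic and has orthonormal columns, i.e. is of the form $C_G = [G \;\; \mathbb{J}_{2k}^{\mathsf T} G]$. More precisely, in each of these cases the resulting matrix can be written as $V_E = [E \;\; \mathbb{J}_{2n}^{\mathsf T} E]$ and is symplectic with orthonormal columns, where, respectively, $$E_{\mathrm{CT}} = \begin{bmatrix} \Phi_{\mathrm{CT}} \\ 0_{n\times k}\end{bmatrix}, \quad E_{\mathrm{cSVD}} = \begin{bmatrix}\Phi_{\mathrm{cSVD}} \\ \Psi_{\mathrm{cSVD}}\end{bmatrix}, \quad E_{\mathrm{greedy}} = [e_1,\dots,e_k], \quad E_{\mathrm{NLP}} = \widetilde{V}_E\, G,$$ and: (i) $\Phi_{\mathrm{CT}}, \Phi_{\mathrm{cSVD}}, \Psi_{\mathrm{cSVD}} \in \mathbb{R}^{n\times k}$ satisfy $\Phi_{\mathrm{CT}}^{\mathsf T}\Phi_{\mathrm{CT}} = I_k$, $\;\Phi_{\mathrm{cSVD}}^{\mathsf T}\Phi_{\mathrm{cSVD}} + \Psi_{\mathrm{cSVD}}^{\mathsf T}\Psi_{\mathrm{cSVD}} = I_k$, $\;\Phi_{\mathrm{cSVD}}^{\mathsf T}\Psi_{\mathrm{cSVD}} = \Psi_{\mathrm{cSVD}}^{\mathsf T}\Phi_{\mathrm{cSVD}}$, which is equivalent to $E^{\mathsf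 T}E = I_k$ and $E^{\mathsf T}\mathbb{J}_{2n}E = 0_k$ for $E = E_{\mathrm{CT}}$ and $E = E_{\mathrm{cSVD}}$, respectively; (ii) $e_1,\dots,e_k\in\mathbb{R}^{2n}$ are the basis vectors selected by the greedy procedure; (iii) $\widetilde V_E \in \mathbb{R}^{2n\times 2k}$ is a matrix computed by CT or cSVD and $G \in \mathbb{R}^{2k\times r}$, $r\le k$, comes from the coefficient matrix $C_G = [G \;\; \mathbb{J}_{2k}^{\mathsf T}G]$ of the NLP procedure.
   Context: $\mathbb{J}_{2m} = \begin{bmatrix} 0 & I_m \\ -I_m & 0\end{bmatrix} \in \mathbb{R}^{2m\times 2m}$ denotes the Poisson matrix. A matrix $V \in \mathbb{R}^{2n\times 2k}$ is symplectic if $V^{\mathsf T}\mathbb{J}_{2n}V = \mathbb{J}_{2k}$, with symplectic inverse $V^{+} = \mathbb{J}_{2k}^{\mathsf T} V^{\mathsf T} \mathbb{J}_{2n}$, and symplectic, orthonormal if additionally $V^{\mathsf T}V = I_{2k}$. Here $k \le n$, and $X_s = [x_1,\dots,x_{n_s}]\in\mathbb{R}^{2n\times n_s}$ is a given snapshot matrix, $x_j = \begin{bmatrix} q_j\\ p_j\end{bmatrix}$ with $q_j,p_j\in\mathbb{R}^n$. Cotangent Lift: $\Phi_{\mathrm{CT}}\in\mathbb{R}^{n\times k}$ consists of $k$ leading (orthonormal) left-singular vectors of $[q_1,\dots,q_{n_s},p_1,\dots,p_{n_s}]$, and the output is $\begin{bmatrix}\Phi_{\mathrm{CT}} & 0\\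 0 & \Phi_{\mathrm{CT}}\end{bmatrix}$. PSD Complex SVD: $U\in\mathbb{C}^{n\times k}$ minimizes $\|C_s - UU^{*}C_s\|_F^2$ subject to $U^{*}U = I_k$, where $C_s = [q_1+\mathrm{i}p_1,\dots,q_{n_s}+\mathrm{i}p_{n_s}]$; $\Phi_{\mathrm{cSVD}} = \operatorname{Re}U$, $\Psi_{\mathrm{cSVD}} = \operatorname{Im}U$, and the output is $[E \;\; \mathbb{J}_{2n}^{\mathsf T}E]$ with $E = \begin{bmatrix}\Phi_{\mathrm{cSVD}}\\ \Psi_{\mathrm{cSVD}}\end{bmatrix}$. Greedy procedure: $e_1$ is a unit vector in $\mathbb{R}^{2n}$; given $V_j = [e_1,\dots,e_j,\mathbb{J}_{2n}^{\mathsf T}e_1,\dots,\mathbb{J}_{2n}^{\mathsf T}e_j]$, a snapshot $x$ (chosen by some error criterion) with $z = x - V_jV_j^{+}x \neq 0$ is selected and $e_{j+1} = z/\|z\|_2$; the output is $V_k = [e_1,\dots,e_k,\mathbb{J}_{2n}^{\mathsf T}e_1,\dots,\mathbb{J}_{2n}^{\mathsf T}e_k]$. NLP procedure: starting from $\widetilde V_E\in\mathbb{R}^{2n\times 2k}$ computed by CT or cSVD, it outputs $\widetilde V_E C$ with a symplectic coefficient matrix $C\in\mathbb{R}^{2k\times 2r}$, i.e. $C^{\mathsf T}\mathbb{J}_{2k}C = \mathbb{J}_{2r}$, for some $r\le k$. *)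

theory Defs
  imports Complex_Main "Jordan_Normal_Form.Schur_Decomposition"
begin

definition append_cols :: "'a :: zero mat \<Rightarrow> 'a mat \<Rightarrow> 'a mat" (infixr "@\<^sub>c" 65) where
  "A @\<^sub>c B = four_block_mat A B (0\<^sub>m 0 (dim_col A)) (0\<^sub>m 0 (dim_col B))"

text \<open>The index is half the dimension: \<open>poisson m\<close> is the \<open>2m \<times> 2m\<close> matrix.\<close>

definition poisson :: "nat \<Rightarrow> real mat" where
  "poisson m = four_block_mat (0\<^sub>m m m) (1\<^sub>m m) (- 1\<^sub>m m) (0\<^sub>m m m)"

definition symplectic :: "nat \<Rightarrow> nat \<Rightarrow> real mat \<Rightarrow> bool" where
  "symplectic n k V \<longleftrightarrow> V \<in> carrier_mat (2 * n) (2 * k) \<and>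
     transpose_mat V * poisson n * V = poisson k"

definition symplectic_inverse :: "nat \<Rightarrow> nat \<Rightarrow> real mat \<Rightarrow> real mat" where
  "symplectic_inverse n k V = transpose_mat (poisson k) * transpose_mat V * poisson n"

definition orthonormal_columns :: "real mat \<Rightarrow> bool" where
  "orthonormal_columns V \<longleftrightarrow> transpose_mat V * V = 1\<^sub>m (dim_col V)"

definition symplectic_orthonormal :: "nat \<Rightarrow> nat \<Rightarrow> real mat \<Rightarrow> bool" where
  "symplectic_orthonormal n k V \<longleftrightarrow> symplectic n k V \<and> orthonormal_columns V"

definition poisson_extension :: "nat \<Rightarrow> real mat \<Rightarrow> real mat" where
  "poisson_extension n E = E @\<^sub>c (transpose_mat (poisson n) * E)"

text \<open>A full singular value decomposition \<open>A = U S W\<^sup>T\<close>, singular values in decreasing order.\<close>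

definition is_svd :: "real mat \<Rightarrow> real mat \<Rightarrow> real mat \<Rightarrow> real mat \<Rightarrow> bool" where
  "is_svd A U S W \<longleftrightarrow>
     U \<in> carrier_mat (dim_row A) (dim_row A) \<and> orthonormal_columns U \<and>
     W \<in> carrier_mat (dim_col A) (dim_col A) \<and> orthonormal_columns W \<and>
     S \<in> carrier_mat (dim_row A) (dim_col A) \<and> diagonal_mat S \<and>
     (\<forall>i < min (dim_row A) (dim_col A). 0 \<le> S $$ (i, i)) \<and>
     (\<forall>i j. i \<le> j \<longrightarrow> j < min (dim_row A) (dim_col A) \<longrightarrow> S $$ (j, j) \<le> S $$ (i, i)) \<and>
     A = U * S * transpose_mat W"

definition leading_left_singular_vectors :: "real mat \<Rightarrow> nat \<Rightarrow> real mat \<Rightarrow> bool" where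
  "leading_left_singular_vectors A k \<Phi> \<longleftrightarrow>
     (\<exists>U S W. is_svd A U S W \<and> \<Phi> = mat_of_cols (dim_row A) (take k (cols U)))"

text \<open>Every column of the snapshot matrix \<open>X\<close> is \<open>x = (q, p)\<close> with \<open>q, p\<close> of dimension \<open>n\<close>.\<close>

definition qp_snapshots :: "nat \<Rightarrow> real mat \<Rightarrow> real mat" where
  "qp_snapshots n X =
     mat_of_cols n (map (\<lambda>x. vec_first x n) (cols X) @ map (\<lambda>x. vec_last x n) (cols X))"

definition complex_snapshots :: "nat \<Rightarrow> real mat \<Rightarrow> complex mat" where
  "complex_snapshots n X =
     mat n (dim_col X) (\<lambda>(i, j). Complex (vec_first (col X j) n $ i) (vec_last (col X j) n $ i))"

definition cotangent_lift :: "nat \<Rightarrow> nat \<Rightarrow> real mat \<Rightarrow> real mat \<Rightarrow> bool" where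
  "cotangent_lift n k X \<Phi> \<longleftrightarrow> leading_left_singular_vectors (qp_snapshots n X) k \<Phi>"

definition cotangent_lift_basis :: "nat \<Rightarrow> nat \<Rightarrow> real mat \<Rightarrow> real mat" where
  "cotangent_lift_basis n k \<Phi> = four_block_mat \<Phi> (0\<^sub>m n k) (0\<^sub>m n k) \<Phi>"

definition frobenius_norm_sq :: "complex mat \<Rightarrow> real" where
  "frobenius_norm_sq A = (\<Sum>i < dim_row A. \<Sum>j < dim_col A. (cmod (A $$ (i, j)))\<^sup>2)"

definition complex_svd :: "nat \<Rightarrow> nat \<Rightarrow> real mat \<Rightarrow> complex mat \<Rightarrow> bool" where
  "complex_svd n k X U \<longleftrightarrow>
     is_arg_min (\<lambda>U. frobenius_norm_sq
         (complex_snapshots n X - U * mat_adjoint U * complex_snapshots n X))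
       (\<lambda>U. U \<in> carrier_mat n k \<and> mat_adjoint U * U = 1\<^sub>m k) U"

definition complex_svd_basis :: "nat \<Rightarrow> complex mat \<Rightarrow> real mat" where
  "complex_svd_basis n U = poisson_extension n (map_mat Re U @\<^sub>r map_mat Im U)"

definition greedy_basis :: "nat \<Rightarrow> real vec list \<Rightarrow> real mat" where
  "greedy_basis n es = mat_of_cols (2 * n) (es @ map (\<lambda>e. transpose_mat (poisson n) *\<^sub>v e) es)"

text \<open>
  The lists \<open>[e\<^sub>1, \<dots>, e\<^sub>j]\<close> which a run of the greedy procedure can generate. The selection of the
  next snapshot is nondeterministic, so that every error criterion is covered.
\<close>

inductive greedy :: "nat \<Rightarrow> real mat \<Rightarrow> real vec list \<Rightarrow> bool" for n :: nat and X :: "real mat" where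
  init: "e \<in> carrier_vec (2 * n) \<Longrightarrow> sqrt (e \<bullet> e) = 1 \<Longrightarrow> greedy n X [e]"
| extend: "greedy n X es \<Longrightarrow> x \<in> set (cols X) \<Longrightarrow> V = greedy_basis n es \<Longrightarrow>
    z = x - V *\<^sub>v (symplectic_inverse n (length es) V *\<^sub>v x) \<Longrightarrow> z \<noteq> 0\<^sub>v (2 * n) \<Longrightarrow>
    greedy n X (es @ [(1 / sqrt (z \<bullet> z)) \<cdot>\<^sub>v z])"

definition ct_or_csvd_basis :: "nat \<Rightarrow> nat \<Rightarrow> real mat \<Rightarrow> real mat \<Rightarrow> bool" where
  "ct_or_csvd_basis n k X V \<longleftrightarrow>
     (\<exists>\<Phi>. cotangent_lift n k X \<Phi> \<and> V = cotangent_lift_basis n k \<Phi>) \<or>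
     (\<exists>U. complex_svd n k X U \<and> V = complex_svd_basis n U)"

text \<open>A run of the NLP procedure with initial basis \<open>V\<close>, coefficient matrix \<open>C\<close> and output \<open>W\<close>.\<close>

definition nlp :: "nat \<Rightarrow> nat \<Rightarrow> nat \<Rightarrow> real mat \<Rightarrow> real mat \<Rightarrow> real mat \<Rightarrow> real mat \<Rightarrow> bool" where
  "nlp n k r X V C W \<longleftrightarrow>
     r \<le> k \<and> ct_or_csvd_basis n k X V \<and> symplectic k r C \<and> W = V * C"

end

theory Submission
  imports Defs
begin

text \<open>
  Identify \<open>(q, p)\<close> in \<open>\<real>\<^sup>2\<^sup>n\<close> with \<open>q + i p\<close> in \<open>\<complex>\<^sup>n\<close>. Then \<open>J\<close> acts as multiplication by \<open>- i\<close>, a real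
  matrix is the real form of a complex one exactly if it commutes with \<open>J\<close>, and the real and
  imaginary parts of the Hermitian inner product are \<open>u\<^sup>T v\<close> and \<open>u\<^sup>T J v\<close>. The theorem
  says that every procedure produces the real form of a complex matrix with orthonormal columns.

  Three facts carry this. A matrix has the shape \<open>[E, J\<^sup>T E]\<close> if and only if \<open>J V = V J\<close>
  (\<open>poisson_extension_iff_commutes\<close>). A commuting matrix is symplectic if and only if its columns are
  orthonormal (\<open>symplectic_iff_orthonormal_of_commutes\<close>); written out for \<open>[E, J\<^sup>T E]\<close> this becomes
  \<open>E\<^sup>T E = I\<close> and \<open>E\<^sup>T J E = 0\<close>. Conversely, symplecticity together with orthonormality forces
  commutation (\<open>symplectic_orthonormal_commutes\<close>), because the commutator \<open>D\<close> satisfies \<open>D\<^sup>T D = 0\<close>.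

  For the cotangent lift and the complex SVD the conditions on \<open>E\<close> are those on its blocks \<open>\<Phi>\<close> and \<open>\<Psi>\<close>,
  and for the complex SVD they are the real and imaginary parts of \<open>U\<^sup>* U = I\<close>. In the greedy procedure
  commutation gives \<open>V\<^sup>+ = V\<^sup>T\<close> (\<open>symplectic_inverse_eq_transpose\<close>), so that each step is a Gram--Schmidt
  step for the Hermitian inner product. For the NLP procedure, the coefficient matrices with
  orthonormal columns are those of the form \<open>[G, J\<^sup>T G]\<close>, and commutation and orthonormality
  both pass to the product with the initial basis.
\<close>

section \<open>The Poisson matrix\<close>

lemma poisson_carrier [simp]: "poisson m \<in> carrier_mat (2 * m) (2 * m)"
  unfolding poisson_def mult_2 by (rule four_block_carrier_mat) simp_all

lemma dim_poisson [simp]: "dim_row (poisson m) = 2 * m" "dim_col (poisson m) = 2 * m"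
  using poisson_carrier[of m] by (auto simp del: poisson_carrier)

lemma transpose_poisson: "transpose_mat (poisson m) = - poisson m"
  by (rule eq_matI) (auto simp: poisson_def)

lemma poisson_mult_append_rows:
  assumes "A \<in> carrier_mat m l" "B \<in> carrier_mat m l"
  shows "poisson m * (A @\<^sub>r B) = B @\<^sub>r (- A)"
proof -
  have "poisson m * (A @\<^sub>r B) =
      four_block_mat (0\<^sub>m m m * A + 1\<^sub>m m * B) (0\<^sub>m m m * 0\<^sub>m m 0 + 1\<^sub>m m * 0\<^sub>m m 0)
        (- 1\<^sub>m m * A + 0\<^sub>m m m * B) (- 1\<^sub>m m * 0\<^sub>m m 0 + 0\<^sub>m m m * 0\<^sub>m m 0)"
    unfolding poisson_def append_rows_def using assms
    by (subst mult_four_block_mat[where ?n1.0 = m and ?n2.0 = m]) auto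
  also have "\<dots> = B @\<^sub>r (- A)"
    unfolding append_rows_def using assms by (intro cong_four_block_mat) auto
  finally show ?thesis .
qed

lemma poisson_square: "poisson m * poisson m = - 1\<^sub>m (2 * m)"
proof -
  have "poisson m * poisson m =
      four_block_mat (0\<^sub>m m m * 0\<^sub>m m m + 1\<^sub>m m * - 1\<^sub>m m) (0\<^sub>m m m * 1\<^sub>m m + 1\<^sub>m m * 0\<^sub>m m m)
        (- 1\<^sub>m m * 0\<^sub>m m m + 0\<^sub>m m m * - 1\<^sub>m m) (- 1\<^sub>m m * 1\<^sub>m m + 0\<^sub>m m m * 0\<^sub>m m m)"
    unfolding poisson_def
    by (subst mult_four_block_mat[where ?n1.0 = m and ?n2.0 = m]) auto
  also have "\<dots> = - 1\<^sub>m (2 * m)" by (rule eq_matI) auto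
  finally show ?thesis .
qed

lemma transpose_poisson_mult_poisson: "transpose_mat (poisson m) * poisson m = 1\<^sub>m (2 * m)"
  by (simp add: transpose_poisson poisson_square)

lemma poisson_mult_cancel:
  assumes "A \<in> carrier_mat (2 * m) l"
  shows "poisson m * (poisson m * A) = - A"
proof -
  have "poisson m * (poisson m * A) = poisson m * poisson m * A"
    using assms by (simp add: assoc_mult_mat[of _ "2 * m" "2 * m" _ "2 * m" _ l])
  then show ?thesis using assms by (simp add: poisson_square)
qed

section \<open>Block columns\<close>

lemma append_cols_carrier [simp]:
  assumes "A \<in> carrier_mat m k" "B \<in> carrier_mat m l"
  shows "A @\<^sub>c B \<in> carrier_mat m (k + l)"
  using assms unfolding append_cols_def carrier_mat_def by auto

lemma index_append_cols:
  assumes "A \<in> carrier_mat m k" "B \<in> carrier_mat m l" "i < m" "j < k + l"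
  shows "(A @\<^sub>c B) $$ (i, j) = (if j < k then A $$ (i, j) else B $$ (i, j - k))"
  using assms unfolding append_cols_def by auto

lemma append_cols_inject:
  assumes "A \<in> carrier_mat m k" "A' \<in> carrier_mat m k" "B \<in> carrier_mat m l" "B' \<in> carrier_mat m l"
  shows "A @\<^sub>c B = A' @\<^sub>c B' \<longleftrightarrow> A = A' \<and> B = B'"
proof
  assume eq: "A @\<^sub>c B = A' @\<^sub>c B'"
  have entry: "(A @\<^sub>c B) $$ (i, j) = (A' @\<^sub>c B') $$ (i, j)" for i j by (simp add: eq)
  have "A = A'"
  proof (rule eq_matI)
    fix i j assume "i < dim_row A'" "j < dim_col A'"
    then show "A $$ (i, j) = A' $$ (i, j)"
      using entry[of i j] assms by (simp add: index_append_cols[where m = m and k = k and l = l])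
  qed (use assms in auto)
  moreover have "B = B'"
  proof (rule eq_matI)
    fix i j assume "i < dim_row B'" "j < dim_col B'"
    then show "B $$ (i, j) = B' $$ (i, j)"
      using entry[of i "k + j"] assms
      by (simp add: index_append_cols[where m = m and k = k and l = l])
  qed (use assms in auto)
  ultimately show "A = A' \<and> B = B'" by simp
qed simp

lemma append_cols_split:
  assumes "V \<in> carrier_mat m (k + l)"
  obtains A B where "A \<in> carrier_mat m k" "B \<in> carrier_mat m l" "V = A @\<^sub>c B"
proof
  show "V = mat m k (\<lambda>(i, j). V $$ (i, j)) @\<^sub>c mat m l (\<lambda>(i, j). V $$ (i, k + j))"
    using assms by (intro eq_matI) (auto simp: append_cols_def)
qed auto

lemma mult_append_cols:
  assumes "M \<in> carrier_mat r m" "A \<in> carrier_mat m k" "B \<in> carrier_mat m l"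
  shows "M * (A @\<^sub>c B) = (M * A) @\<^sub>c (M * B)"
proof (rule eq_matI)
  fix i j assume "i < dim_row ((M * A) @\<^sub>c (M * B))" "j < dim_col ((M * A) @\<^sub>c (M * B))"
  then have i: "i < r" and j: "j < k + l" using assms by (auto simp: append_cols_def)
  have "col (A @\<^sub>c B) j = (if j < k then col A j else col B (j - k))"
    using assms j by (intro eq_vecI) (auto simp: append_cols_def)
  then show "(M * (A @\<^sub>c B)) $$ (i, j) = ((M * A) @\<^sub>c (M * B)) $$ (i, j)"
    using assms i j by (auto simp: append_cols_def)
qed (use assms in \<open>auto simp: append_cols_def\<close>)

lemma append_cols_mult_poisson:
  assumes "A \<in> carrier_mat m k" "B \<in> carrier_mat m k"
  shows "(A @\<^sub>c B) * poisson k = (- B) @\<^sub>c A"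
proof -
  have "(A @\<^sub>c B) * poisson k =
      four_block_mat (A * 0\<^sub>m k k + B * - 1\<^sub>m k) (A * 1\<^sub>m k + B * 0\<^sub>m k k)
        (0\<^sub>m 0 k * 0\<^sub>m k k + 0\<^sub>m 0 k * - 1\<^sub>m k) (0\<^sub>m 0 k * 1\<^sub>m k + 0\<^sub>m 0 k * 0\<^sub>m k k)"
    unfolding poisson_def append_cols_def using assms
    by (subst mult_four_block_mat[where ?n1.0 = k and ?n2.0 = k]) auto
  also have "\<dots> = (- B) @\<^sub>c A"
    unfolding append_cols_def using assms by (intro cong_four_block_mat) auto
  finally show ?thesis .
qed

lemma transpose_append_cols_mult:
  fixes A B A' B' :: "'a :: comm_ring_1 mat"
  assumes "A \<in> carrier_mat m k" "B \<in> carrier_mat m l" "A' \<in> carrier_mat m k'" "B' \<in> carrier_mat m l'"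
  shows "transpose_mat (A @\<^sub>c B) * (A' @\<^sub>c B') =
    four_block_mat (transpose_mat A * A') (transpose_mat A * B')
      (transpose_mat B * A') (transpose_mat B * B')"
proof -
  have "transpose_mat (A @\<^sub>c B) =
      four_block_mat (transpose_mat A) (0\<^sub>m k 0) (transpose_mat B) (0\<^sub>m l 0)"
    unfolding append_cols_def using assms
    by (subst transpose_four_block_mat[of _ m k _ l _ 0]) auto
  also have "\<dots> * (A' @\<^sub>c B') = four_block_mat
      (transpose_mat A * A' + 0\<^sub>m k 0 * 0\<^sub>m 0 k') (transpose_mat A * B' + 0\<^sub>m k 0 * 0\<^sub>m 0 l')
      (transpose_mat B * A' + 0\<^sub>m l 0 * 0\<^sub>m 0 k') (transpose_mat B * B' + 0\<^sub>m l 0 * 0\<^sub>m 0 l')"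
    unfolding append_cols_def using assms
    by (subst mult_four_block_mat[of _ k m _ 0 _ l _ _ k' _ l']) auto
  also have "\<dots> = four_block_mat (transpose_mat A * A') (transpose_mat A * B')
      (transpose_mat B * A') (transpose_mat B * B')"
    using assms by (intro cong_four_block_mat) auto
  finally show ?thesis .
qed

lemma four_block_mat_eq_one_iff:
  assumes "A \<in> carrier_mat k k" "B \<in> carrier_mat k l" "C \<in> carrier_mat l k" "D \<in> carrier_mat l l"
  shows "four_block_mat A B C D = 1\<^sub>m (k + l) \<longleftrightarrow> A = 1\<^sub>m k \<and> B = 0\<^sub>m k l \<and> C = 0\<^sub>m l k \<and> D = 1\<^sub>m l"
proof
  assume eq: "four_block_mat A B C D = 1\<^sub>m (k + l)"
  have entry: "four_block_mat A B C D $$ (i, j) = 1\<^sub>m (k + l) $$ (i, j)" for i j by (simp add: eq)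
  have "A $$ (i, j) = 1\<^sub>m k $$ (i, j)" if "i < k" "j < k" for i j
    using entry[of i j] that assms by auto
  moreover have "B $$ (i, j) = 0" if "i < k" "j < l" for i j
    using entry[of i "k + j"] that assms by auto
  moreover have "C $$ (i, j) = 0" if "i < l" "j < k" for i j
    using entry[of "k + i" j] that assms by auto
  moreover have "D $$ (i, j) = 1\<^sub>m l $$ (i, j)" if "i < l" "j < l" for i j
    using entry[of "k + i" "k + j"] that assms by auto
  ultimately show "A = 1\<^sub>m k \<and> B = 0\<^sub>m k l \<and> C = 0\<^sub>m l k \<and> D = 1\<^sub>m l"
    using assms by (intro conjI eq_matI) auto
qed simp

section \<open>Commutation with the Poisson matrix\<close>

lemma poisson_extension_carrier [simp]:
  assumes "E \<in> carrier_mat (2 * n) k"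
  shows "poisson_extension n E \<in> carrier_mat (2 * n) (2 * k)"
  unfolding poisson_extension_def mult_2[of k] using assms
  by (intro append_cols_carrier) (auto intro!: mult_carrier_mat)

lemma poisson_extension_alt:
  assumes "E \<in> carrier_mat (2 * n) k"
  shows "poisson_extension n E = E @\<^sub>c (- (poisson n * E))"
  using assms by (simp add: poisson_extension_def transpose_poisson)

text \<open>
  Multiplying \<open>V = [A B]\<close> by \<open>J\<close> from the left gives \<open>[J A, J B]\<close> and from the right \<open>[- B, A]\<close>.
  Equality of the left blocks forces \<open>B = - J A = J\<^sup>T A\<close>, and then \<open>J\<^sup>2 = - I\<close> gives the right blocks.
  Commutation, unlike the block shape, passes to products and transposes by inspection.
\<close>

lemma poisson_extension_iff_commutes:
  assumes "V \<in> carrier_mat (2 * n) (2 * k)"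
  shows "(\<exists>E \<in> carrier_mat (2 * n) k. V = poisson_extension n E) \<longleftrightarrow>
    poisson n * V = V * poisson k"
proof -
  obtain A B where AB: "A \<in> carrier_mat (2 * n) k" "B \<in> carrier_mat (2 * n) k" "V = A @\<^sub>c B"
    using append_cols_split[of V "2 * n" k k] assms by (auto simp: mult_2)
  have JA: "poisson n * A \<in> carrier_mat (2 * n) k" and JB: "poisson n * B \<in> carrier_mat (2 * n) k"
    using AB by (auto intro: mult_carrier_mat)
  have "poisson n * V = V * poisson k \<longleftrightarrow>
      (poisson n * A) @\<^sub>c (poisson n * B) = (- B) @\<^sub>c A"
    unfolding AB(3) mult_append_cols[OF poisson_carrier AB(1,2)] append_cols_mult_poisson[OF AB(1,2)] ..
  also have "\<dots> \<longleftrightarrow> poisson n * A = - B \<and> poisson n * B = A"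
    using AB(1,2) JA JB by (intro append_cols_inject) auto
  also have "\<dots> \<longleftrightarrow> B = - (poisson n * A)"
  proof
    assume B: "B = - (poisson n * A)"
    have "poisson n * B = - (poisson n * (poisson n * A))"
      unfolding B using AB JA by (intro uminus_mult_right_mat) auto
    then show "poisson n * A = - B \<and> poisson n * B = A"
      unfolding poisson_mult_cancel[OF AB(1)] by (simp add: B)
  next
    assume "poisson n * A = - B \<and> poisson n * B = A"
    then have "poisson n * A = - B" by blast
    then show "B = - (poisson n * A)" by (metis uminus_uminus_mat)
  qed
  also have "\<dots> \<longleftrightarrow> (\<exists>E \<in> carrier_mat (2 * n) k. V = poisson_extension n E)"
  proof -
    have "V = poisson_extension n E \<longleftrightarrow> A = E \<and> B = - (poisson n * E)"
      if "E \<in> carrier_mat (2 * n) k" for E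
      unfolding AB(3) poisson_extension_alt[OF that] using AB(1,2) that
      by (intro append_cols_inject) (auto intro: mult_carrier_mat)
    then show ?thesis using AB(1) by blast
  qed
  finally show ?thesis by simp
qed

text \<open>
  Moving \<open>J\<close> past \<open>V\<close> turns \<open>V\<^sup>T J V\<close> into \<open>(V\<^sup>T V) J\<close>, and \<open>J\<close> is invertible.
\<close>

lemma symplectic_iff_orthonormal_of_commutes:
  assumes V: "V \<in> carrier_mat (2 * n) (2 * k)" and comm: "poisson n * V = V * poisson k"
  shows "symplectic n k V \<longleftrightarrow> orthonormal_columns V"
proof -
  let ?G = "transpose_mat V * V"
  have G: "?G \<in> carrier_mat (2 * k) (2 * k)" using V by (auto intro: mult_carrier_mat)
  have "transpose_mat V * poisson n * V = transpose_mat V * (poisson n * V)"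
    using V by (intro assoc_mult_mat[of _ "2 * k" "2 * n" _ "2 * n" _ "2 * k"]) auto
  also have "\<dots> = ?G * poisson k"
    unfolding comm using V by (intro assoc_mult_mat[symmetric, of _ "2 * k" "2 * n" _ "2 * k" _ "2 * k"]) auto
  finally have form: "transpose_mat V * poisson n * V = ?G * poisson k" .
  have "?G * poisson k = poisson k \<longleftrightarrow> ?G = 1\<^sub>m (2 * k)"
  proof
    assume "?G * poisson k = poisson k"
    then have "?G * poisson k * poisson k = poisson k * poisson k" by simp
    then have "?G * (poisson k * poisson k) = poisson k * poisson k"
      using assoc_mult_mat[OF G poisson_carrier poisson_carrier] by simp
    then have "- (?G * 1\<^sub>m (2 * k)) = - 1\<^sub>m (2 * k)"
      using V unfolding poisson_square by (subst uminus_mult_right_mat[symmetric]) auto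
    then show "?G = 1\<^sub>m (2 * k)" using right_mult_one_mat[OF G] by simp
  qed simp
  then show ?thesis
    unfolding symplectic_def orthonormal_columns_def form using V by simp
qed

lemma mat_zero_of_gram_zero:
  fixes D :: "real mat"
  assumes "D \<in> carrier_mat m l" "transpose_mat D * D = 0\<^sub>m l l"
  shows "D = 0\<^sub>m m l"
proof (rule eq_matI)
  fix i j assume ij: "i < dim_row (0\<^sub>m m l)" "j < dim_col (0\<^sub>m m l)"
  have "col D j \<bullet> col D j = (transpose_mat D * D) $$ (j, j)" using assms(1) ij by simp
  also have "\<dots> = 0" using assms(2) ij by simp
  finally have "(\<Sum>i<m. D $$ (i, j) * D $$ (i, j)) = 0"
    using assms(1) ij by (simp add: scalar_prod_def lessThan_atLeast0)
  then show "D $$ (i, j) = 0\<^sub>m m l $$ (i, j)"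
    using ij by (subst (asm) sum_nonneg_eq_0_iff) auto
qed (use assms in auto)

text \<open>
  Let \<open>D = J V - V J\<close> be the commutator. The two conditions on \<open>V\<close> give \<open>V\<^sup>T D = J - J = 0\<close> and
  \<open>V\<^sup>T (J D) = - I - J\<^sup>2 = 0\<close>. Since \<open>D\<^sup>T = - V\<^sup>T J + J V\<^sup>T\<close>, it follows that \<open>D\<^sup>T D = 0\<close>, so \<open>D = 0\<close>.
  Hence a symplectic matrix with orthonormal columns always has the shape \<open>[E, J\<^sup>T E]\<close>.
\<close>

lemma symplectic_orthonormal_commutes:
  assumes "symplectic_orthonormal n k V"
  shows "poisson n * V = V * poisson k"
proof -
  have V: "V \<in> carrier_mat (2 * n) (2 * k)"
    and form: "transpose_mat V * poisson n * V = poisson k"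
    and gram: "transpose_mat V * V = 1\<^sub>m (2 * k)"
    using assms by (auto simp: symplectic_orthonormal_def symplectic_def orthonormal_columns_def)
  let ?Jn = "poisson n" and ?Jk = "poisson k" and ?Vt = "transpose_mat V"
  define D where "D = ?Jn * V - V * ?Jk"
  have Vt: "?Vt \<in> carrier_mat (2 * k) (2 * n)" using V by simp
  have JV: "?Jn * V \<in> carrier_mat (2 * n) (2 * k)" and VJ: "V * ?Jk \<in> carrier_mat (2 * n) (2 * k)"
    using V by (auto intro: mult_carrier_mat)
  have D: "D \<in> carrier_mat (2 * n) (2 * k)" using JV VJ by (simp add: D_def minus_carrier_mat)
  have VtD: "?Vt * D = 0\<^sub>m (2 * k) (2 * k)"
  proof -
    have "?Vt * D = ?Vt * (?Jn * V) - ?Vt * (V * ?Jk)"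
      unfolding D_def using V JV VJ Vt by (intro mult_minus_distrib_mat) auto
    also have "?Vt * (?Jn * V) = ?Jk"
      using form assoc_mult_mat[OF Vt poisson_carrier V] by simp
    also have "?Vt * (V * ?Jk) = ?Jk"
      using gram assoc_mult_mat[OF Vt V poisson_carrier, symmetric] by simp
    finally show ?thesis using minus_r_inv_mat[OF poisson_carrier[of k]] by simp
  qed
  have VtJD: "?Vt * (?Jn * D) = 0\<^sub>m (2 * k) (2 * k)"
  proof -
    have "?Jn * D = ?Jn * (?Jn * V) - ?Jn * (V * ?Jk)"
      unfolding D_def using V JV VJ by (intro mult_minus_distrib_mat) auto
    also have "?Jn * (?Jn * V) = - V" using V by (rule poisson_mult_cancel)
    finally have "?Vt * (?Jn * D) = ?Vt * (- V - ?Jn * (V * ?Jk))" by simp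
    also have "\<dots> = ?Vt * (- V) - ?Vt * (?Jn * (V * ?Jk))"
      using V VJ Vt by (intro mult_minus_distrib_mat) (auto intro: mult_carrier_mat)
    also have "?Vt * (- V) = - 1\<^sub>m (2 * k)" using gram V by simp
    also have "?Jn * (V * ?Jk) = ?Jn * V * ?Jk"
      using V by (intro assoc_mult_mat[symmetric]) auto
    also have "?Vt * (?Jn * V * ?Jk) = ?Vt * (?Jn * V) * ?Jk"
      using Vt JV by (intro assoc_mult_mat[symmetric]) auto
    also have "?Vt * (?Jn * V) = ?Vt * ?Jn * V"
      using V Vt by (intro assoc_mult_mat[symmetric]) auto
    also have "?Vt * ?Jn * V * ?Jk = - 1\<^sub>m (2 * k)" unfolding form by (rule poisson_square)
    finally show ?thesis by (simp add: minus_r_inv_mat[of _ "2 * k" "2 * k"])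
  qed
  have "transpose_mat D = - (?Vt * ?Jn) - - (?Jk * ?Vt)"
    unfolding D_def using V JV VJ
    by (simp add: transpose_minus[of _ "2 * n" "2 * k"] transpose_mult[of _ "2 * n" "2 * n" _ "2 * k"]
      transpose_mult[of _ "2 * n" "2 * k" _ "2 * k"] transpose_poisson)
  then have "transpose_mat D * D = - (?Vt * ?Jn) * D - - (?Jk * ?Vt) * D"
    using minus_mult_distrib_mat[of "- (?Vt * ?Jn)" "2 * k" "2 * n" "- (?Jk * ?Vt)" D "2 * k"]
      D mult_carrier_mat[OF Vt poisson_carrier] mult_carrier_mat[OF poisson_carrier Vt] by simp
  also have "\<dots> = - (?Vt * (?Jn * D)) - - (?Jk * (?Vt * D))"
    using D V by (simp add: assoc_mult_mat[of _ "2 * k" "2 * n" _ "2 * n" _ "2 * k"]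
      assoc_mult_mat[of _ "2 * k" "2 * k" _ "2 * n" _ "2 * k"])
  also have "\<dots> = 0\<^sub>m (2 * k) (2 * k)"
    unfolding VtD VtJD by (auto intro!: eq_matI)
  finally have "D = 0\<^sub>m (2 * n) (2 * k)" using mat_zero_of_gram_zero D by blast
  then have "(?Jn * V - V * ?Jk) $$ (i, j) = 0" if "i < 2 * n" "j < 2 * k" for i j
    using that by (simp add: D_def)
  then show ?thesis using JV VJ V by (intro eq_matI) auto
qed

lemma uminus_zero_mat: "- (0\<^sub>m m l :: 'a :: group_add mat) = 0\<^sub>m m l"
  by (rule eq_matI) auto

text \<open>
  The Gram matrix of \<open>[E, J\<^sup>T E]\<close> has the diagonal blocks \<open>E\<^sup>T E\<close> and the off-diagonal blocks
  \<open>- E\<^sup>T J E\<close> and \<open>E\<^sup>T J E\<close>. Orthonormality alone is thus the right-hand side, and it entails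
  symplecticity because the extension commutes with \<open>J\<close>.
\<close>

lemma symplectic_orthonormal_poisson_extension_iff:
  assumes E: "E \<in> carrier_mat (2 * n) k"
  shows "symplectic_orthonormal n k (poisson_extension n E) \<longleftrightarrow>
    transpose_mat E * E = 1\<^sub>m k \<and> transpose_mat E * poisson n * E = 0\<^sub>m k k"
proof -
  let ?V = "poisson_extension n E" and ?Et = "transpose_mat E" and ?J = "poisson n"
  have V: "?V \<in> carrier_mat (2 * n) (2 * k)" using E by simp
  have Et: "?Et \<in> carrier_mat k (2 * n)" using E by simp
  have JE: "?J * E \<in> carrier_mat (2 * n) k" using E by (auto intro: mult_carrier_mat)
  have assoc: "?Et * (?J * E) = ?Et * ?J * E"
    using assoc_mult_mat[OF Et poisson_carrier E] by simp
  have tr: "transpose_mat (- (?J * E)) = ?Et * ?J"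
    using E by (simp add: transpose_uminus transpose_mult[of _ "2 * n" "2 * n" _ k] transpose_poisson)
  have "?Et * ?J * (?J * E) = ?Et * (?J * (?J * E))"
    using Et JE by (intro assoc_mult_mat) auto
  then have JJ: "?Et * ?J * (?J * E) = - (?Et * E)"
    using E by (simp add: poisson_mult_cancel)
  have "transpose_mat ?V * ?V = four_block_mat (?Et * E) (?Et * (- (?J * E)))
      (transpose_mat (- (?J * E)) * E) (transpose_mat (- (?J * E)) * (- (?J * E)))"
    unfolding poisson_extension_alt[OF E] using E JE
    by (intro transpose_append_cols_mult) auto
  also have "\<dots> = four_block_mat (?Et * E) (- (?Et * ?J * E)) (?Et * ?J * E) (?Et * E)"
    unfolding tr using E JE by (intro cong_four_block_mat) (simp_all add: assoc JJ)
  finally have gram: "transpose_mat ?V * ?V =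
    four_block_mat (?Et * E) (- (?Et * ?J * E)) (?Et * ?J * E) (?Et * E)" .
  have "symplectic_orthonormal n k ?V \<longleftrightarrow> orthonormal_columns ?V"
    unfolding symplectic_orthonormal_def
    using symplectic_iff_orthonormal_of_commutes[OF V] poisson_extension_iff_commutes[OF V] E by blast
  also have "\<dots> \<longleftrightarrow> ?Et * E = 1\<^sub>m k \<and> - (?Et * ?J * E) = 0\<^sub>m k k \<and> ?Et * ?J * E = 0\<^sub>m k k \<and> ?Et * E = 1\<^sub>m k"
  proof -
    have "dim_col ?V = k + k" using V by simp
    moreover have "?Et * E \<in> carrier_mat k k" "?Et * ?J * E \<in> carrier_mat k k"
      using Et E by (auto intro!: mult_carrier_mat)
    ultimately show ?thesis
      unfolding orthonormal_columns_def gram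
      using four_block_mat_eq_one_iff[of "?Et * E" k "- (?Et * ?J * E)" k "?Et * ?J * E" "?Et * E"]
      by simp
  qed
  also have "\<dots> \<longleftrightarrow> ?Et * E = 1\<^sub>m k \<and> ?Et * ?J * E = 0\<^sub>m k k"
    using uminus_zero_mat by metis
  finally show ?thesis .
qed

text \<open>
  Transposing \<open>J V = V J\<close> gives \<open>V\<^sup>T J = J V\<^sup>T\<close>, whence \<open>V\<^sup>+ = J\<^sup>T V\<^sup>T J = J\<^sup>T J V\<^sup>T = V\<^sup>T\<close>.
  Therefore \<open>V V\<^sup>+\<close> is an orthogonal projection, and the greedy step is a Gram--Schmidt step.
\<close>

lemma symplectic_inverse_eq_transpose:
  assumes "symplectic_orthonormal n k V"
  shows "symplectic_inverse n k V = transpose_mat V"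
proof -
  have V: "V \<in> carrier_mat (2 * n) (2 * k)"
    using assms by (simp add: symplectic_orthonormal_def symplectic_def)
  have "transpose_mat (poisson n * V) = transpose_mat (V * poisson k)"
    using symplectic_orthonormal_commutes[OF assms] by simp
  then have comm: "transpose_mat V * poisson n = poisson k * transpose_mat V"
    using V by (simp add: transpose_mult[of _ "2 * n" "2 * n" _ "2 * k"]
      transpose_mult[of _ "2 * n" "2 * k" _ "2 * k"] transpose_poisson)
  have "symplectic_inverse n k V = transpose_mat (poisson k) * (transpose_mat V * poisson n)"
    unfolding symplectic_inverse_def using V
    by (intro assoc_mult_mat[of _ "2 * k" "2 * k" _ "2 * n" _ "2 * n"]) auto
  also have "\<dots> = transpose_mat (poisson k) * poisson k * transpose_mat V"
    unfolding comm using V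
    by (intro assoc_mult_mat[symmetric, of _ "2 * k" "2 * k" _ "2 * k" _ "2 * n"]) auto
  finally show ?thesis using V by (simp add: transpose_poisson_mult_poisson)
qed

lemma symplectic_orthonormal_mult:
  assumes "symplectic_orthonormal n k V" "symplectic_orthonormal k r C"
  shows "symplectic_orthonormal n r (V * C)"
proof -
  have V: "V \<in> carrier_mat (2 * n) (2 * k)" and C: "C \<in> carrier_mat (2 * k) (2 * r)"
    and gV: "transpose_mat V * V = 1\<^sub>m (2 * k)" and gC: "transpose_mat C * C = 1\<^sub>m (2 * r)"
    using assms by (auto simp: symplectic_orthonormal_def symplectic_def orthonormal_columns_def)
  have VC: "V * C \<in> carrier_mat (2 * n) (2 * r)" using V C by (rule mult_carrier_mat)
  have "poisson n * (V * C) = poisson n * V * C"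
    using assoc_mult_mat[OF poisson_carrier V C] by simp
  also have "\<dots> = V * (poisson k * C)"
    unfolding symplectic_orthonormal_commutes[OF assms(1)]
    using V C by (intro assoc_mult_mat) auto
  also have "\<dots> = V * C * poisson r"
    unfolding symplectic_orthonormal_commutes[OF assms(2)]
    using V C by (intro assoc_mult_mat[symmetric]) auto
  finally have comm: "poisson n * (V * C) = V * C * poisson r" .
  have "transpose_mat (V * C) * (V * C) = transpose_mat C * transpose_mat V * (V * C)"
    using V C by (simp add: transpose_mult)
  also have "\<dots> = transpose_mat C * (transpose_mat V * (V * C))"
    using V C VC by (intro assoc_mult_mat) auto
  also have "transpose_mat V * (V * C) = transpose_mat V * V * C"
    using V C by (intro assoc_mult_mat[symmetric, of _ "2 * k" "2 * n" _ "2 * k" _ "2 * r"]) auto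
  finally have "orthonormal_columns (V * C)"
    unfolding orthonormal_columns_def using C gV gC by simp
  then show ?thesis
    unfolding symplectic_orthonormal_def
    using symplectic_iff_orthonormal_of_commutes[OF VC comm] by blast
qed

text \<open>
  Because \<open>V\<close> also commutes with \<open>J\<^sup>T = - J\<close>, the right block \<open>V J\<^sup>T G\<close> is \<open>J\<^sup>T V G\<close>. This is why the NLP
  procedure, which multiplies a given basis by its coefficient matrix, keeps the block shape.
\<close>

lemma mult_poisson_extension:
  assumes V: "V \<in> carrier_mat (2 * n) (2 * k)" and comm: "poisson n * V = V * poisson k"
    and G: "G \<in> carrier_mat (2 * k) r"
  shows "V * poisson_extension k G = poisson_extension n (V * G)"
proof -
  have JG: "poisson k * G \<in> carrier_mat (2 * k) r" and VG: "V * G \<in> carrier_mat (2 * n) r"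
    using V G by (auto intro: mult_carrier_mat)
  have "V * poisson_extension k G = (V * G) @\<^sub>c (V * (- (poisson k * G)))"
    unfolding poisson_extension_alt[OF G] using V G JG by (intro mult_append_cols) auto
  also have "V * (- (poisson k * G)) = - (V * (poisson k * G))"
    using V JG by (intro uminus_mult_right_mat) auto
  also have "V * (poisson k * G) = poisson n * V * G"
    unfolding comm using V G by (intro assoc_mult_mat[symmetric]) auto
  also have "\<dots> = poisson n * (V * G)"
    using V G by (intro assoc_mult_mat) auto
  finally show ?thesis unfolding poisson_extension_alt[OF VG] .
qed

section \<open>Cotangent lift and complex SVD\<close>

lemma transpose_append_rows_mult:
  fixes A B A' B' :: "'a :: comm_ring_1 mat"
  assumes "A \<in> carrier_mat m k" "B \<in> carrier_mat m' k" "A' \<in> carrier_mat m l" "B' \<in> carrier_mat m' l"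
  shows "transpose_mat (A @\<^sub>r B) * (A' @\<^sub>r B') = transpose_mat A * A' + transpose_mat B * B'"
proof (rule eq_matI)
  fix i j
  assume "i < dim_row (transpose_mat A * A' + transpose_mat B * B')"
    "j < dim_col (transpose_mat A * A' + transpose_mat B * B')"
  then have ij: "i < k" "j < l" using assms by auto
  have "col (A @\<^sub>r B) i = col A i @\<^sub>v col B i" "col (A' @\<^sub>r B') j = col A' j @\<^sub>v col B' j"
    using assms ij by (auto intro!: eq_vecI simp: append_rows_def)
  then show "(transpose_mat (A @\<^sub>r B) * (A' @\<^sub>r B')) $$ (i, j) =
      (transpose_mat A * A' + transpose_mat B * B') $$ (i, j)"
    using assms ij by (simp add: append_rows_def scalar_prod_append[of _ m _ m'])
qed (use assms in \<open>auto simp: append_rows_def\<close>)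

lemma minus_mat_eq_zero_iff:
  fixes A B :: "'a :: group_add mat"
  assumes "A \<in> carrier_mat m l" "B \<in> carrier_mat m l"
  shows "A - B = 0\<^sub>m m l \<longleftrightarrow> A = B"
proof
  assume "A - B = 0\<^sub>m m l"
  then have "(A - B) $$ (i, j) = 0" if "i < m" "j < l" for i j using that by simp
  then show "A = B" using assms by (intro eq_matI) auto
qed (use assms in auto)

text \<open>
  Since \<open>J (\<Phi>, \<Psi>) = (\<Psi>, - \<Phi>)\<close>, the product \<open>E\<^sup>T J E\<close> is \<open>\<Phi>\<^sup>T \<Psi> - \<Psi>\<^sup>T \<Phi>\<close>, while \<open>E\<^sup>T E\<close> is
  \<open>\<Phi>\<^sup>T \<Phi> + \<Psi>\<^sup>T \<Psi>\<close>.
\<close>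

lemma append_rows_conditions_iff:
  assumes "\<Phi> \<in> carrier_mat n k" "\<Psi> \<in> carrier_mat n k" and E: "E = \<Phi> @\<^sub>r \<Psi>"
  shows "transpose_mat \<Phi> * \<Phi> + transpose_mat \<Psi> * \<Psi> = 1\<^sub>m k \<and>
      transpose_mat \<Phi> * \<Psi> = transpose_mat \<Psi> * \<Phi> \<longleftrightarrow>
    transpose_mat E * E = 1\<^sub>m k \<and> transpose_mat E * poisson n * E = 0\<^sub>m k k"
proof -
  have Ec: "E \<in> carrier_mat (2 * n) k" unfolding E mult_2 using assms by blast
  have "transpose_mat E * poisson n * E = transpose_mat E * (poisson n * E)"
    using Ec by (intro assoc_mult_mat[of _ k "2 * n" _ "2 * n" _ k]) auto
  also have "poisson n * E = \<Psi> @\<^sub>r (- \<Phi>)"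
    unfolding E using assms by (intro poisson_mult_append_rows)
  also have "transpose_mat E * \<dots> = transpose_mat \<Phi> * \<Psi> + transpose_mat \<Psi> * (- \<Phi>)"
    unfolding E using assms by (intro transpose_append_rows_mult) auto
  also have "\<dots> = transpose_mat \<Phi> * \<Psi> - transpose_mat \<Psi> * \<Phi>"
    using assms by (intro eq_matI) auto
  finally have "transpose_mat E * poisson n * E = 0\<^sub>m k k \<longleftrightarrow>
      transpose_mat \<Phi> * \<Psi> = transpose_mat \<Psi> * \<Phi>"
    using assms by (simp add: minus_mat_eq_zero_iff)
  moreover have "transpose_mat E * E = transpose_mat \<Phi> * \<Phi> + transpose_mat \<Psi> * \<Psi>"
    unfolding E using assms by (intro transpose_append_rows_mult) auto
  ultimately show ?thesis by simp
qed

lemma symplectic_orthonormal_append_rows: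
  assumes "\<Phi> \<in> carrier_mat n k" "\<Psi> \<in> carrier_mat n k"
    and "transpose_mat \<Phi> * \<Phi> + transpose_mat \<Psi> * \<Psi> = 1\<^sub>m k"
    and "transpose_mat \<Phi> * \<Psi> = transpose_mat \<Psi> * \<Phi>"
  shows "symplectic_orthonormal n k (poisson_extension n (\<Phi> @\<^sub>r \<Psi>))"
proof -
  have "\<Phi> @\<^sub>r \<Psi> \<in> carrier_mat (2 * n) k" unfolding mult_2 using assms by blast
  then show ?thesis
    using symplectic_orthonormal_poisson_extension_iff append_rows_conditions_iff[OF assms(1,2) refl] assms(3,4)
    by blast
qed

lemma cotangent_lift_basis_eq_poisson_extension:
  assumes "\<Phi> \<in> carrier_mat n k"
  shows "cotangent_lift_basis n k \<Phi> = poisson_extension n (\<Phi> @\<^sub>r 0\<^sub>m n k)"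
proof -
  have E: "\<Phi> @\<^sub>r 0\<^sub>m n k \<in> carrier_mat (2 * n) k" unfolding mult_2 using assms by (intro carrier_append_rows) auto
  have "poisson_extension n (\<Phi> @\<^sub>r 0\<^sub>m n k) = (\<Phi> @\<^sub>r 0\<^sub>m n k) @\<^sub>c (- (0\<^sub>m n k @\<^sub>r (- \<Phi>)))"
    unfolding poisson_extension_alt[OF E] using assms by (simp add: poisson_mult_append_rows)
  also have "\<dots> = cotangent_lift_basis n k \<Phi>"
  proof (rule eq_matI)
    fix i j
    assume "i < dim_row (cotangent_lift_basis n k \<Phi>)" "j < dim_col (cotangent_lift_basis n k \<Phi>)"
    then have "i < n + n" "j < k + k" using assms by (simp_all add: cotangent_lift_basis_def)
    then show "((\<Phi> @\<^sub>r 0\<^sub>m n k) @\<^sub>c (- (0\<^sub>m n k @\<^sub>r (- \<Phi>)))) $$ (i, j) = cotangent_lift_basis n k \<Phi> $$ (i, j)"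
      using assms by (cases "i < n"; cases "j < k")
        (simp_all add: cotangent_lift_basis_def append_rows_def append_cols_def)
  qed (use assms in \<open>simp_all add: cotangent_lift_basis_def append_rows_def append_cols_def\<close>)
  finally show ?thesis by simp
qed

lemma cotangent_lift_orthonormal:
  assumes "k \<le> n" "cotangent_lift n k X \<Phi>"
  shows "\<Phi> \<in> carrier_mat n k" "transpose_mat \<Phi> * \<Phi> = 1\<^sub>m k"
proof -
  let ?A = "qp_snapshots n X"
  have row: "dim_row ?A = n" by (simp add: qp_snapshots_def)
  obtain U S W where svd: "is_svd ?A U S W" and "\<Phi> = mat_of_cols (dim_row ?A) (take k (cols U))"
    using assms(2) unfolding cotangent_lift_def leading_left_singular_vectors_def by blast
  then have \<Phi>: "\<Phi> = mat_of_cols n (take k (cols U))" unfolding row by blast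
  have "U \<in> carrier_mat (dim_row ?A) (dim_row ?A)" "orthonormal_columns U"
    using svd unfolding is_svd_def by blast+
  then have U: "U \<in> carrier_mat n n" "transpose_mat U * U = 1\<^sub>m n"
    unfolding row orthonormal_columns_def by simp_all
  have len: "length (take k (cols U)) = k" using U(1) assms(1) by simp
  show c: "\<Phi> \<in> carrier_mat n k" unfolding \<Phi> using mat_of_cols_carrier(1)[of n "take k (cols U)"] len by simp
  have col: "col \<Phi> i = col U i" if "i < k" for i
  proof -
    have "take k (cols U) ! i = col U i" using that U(1) assms(1) by simp
    then show ?thesis
      unfolding \<Phi> using that len U(1) by (subst col_mat_of_cols) auto
  qed
  show "transpose_mat \<Phi> * \<Phi> = 1\<^sub>m k"
  proof (rule eq_matI)
    fix i j assume "i < dim_row (1\<^sub>m k :: real mat)" "j < dim_col (1\<^sub>m k :: real mat)"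
    then have ij: "i < k" "j < k" by simp_all
    then have "(transpose_mat \<Phi> * \<Phi>) $$ (i, j) = (transpose_mat U * U) $$ (i, j)"
      using c U(1) assms(1) by (simp add: col)
    also have "\<dots> = 1\<^sub>m k $$ (i, j)" unfolding U(2) using ij assms(1) by simp
    finally show "(transpose_mat \<Phi> * \<Phi>) $$ (i, j) = 1\<^sub>m k $$ (i, j)" .
  qed (use c in auto)
qed

lemma cotangent_lift_symplectic_orthonormal:
  assumes "k \<le> n" "cotangent_lift n k X \<Phi>"
  shows "symplectic_orthonormal n k (cotangent_lift_basis n k \<Phi>)"
proof -
  note \<Phi> = cotangent_lift_orthonormal[OF assms]
  show ?thesis
    unfolding cotangent_lift_basis_eq_poisson_extension[OF \<Phi>(1)] using \<Phi>
    by (intro symplectic_orthonormal_append_rows) simp_all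
qed

text \<open>
  For \<open>U = \<Phi> + i \<Psi>\<close>, expanding \<open>(\<Phi>\<^sup>T - i \<Psi>\<^sup>T) (\<Phi> + i \<Psi>)\<close> separates the condition \<open>U\<^sup>* U = I\<close> into the
  two real conditions on \<open>\<Phi>\<close> and \<open>\<Psi>\<close>.
\<close>

lemma mat_adjoint_mult_self:
  assumes "U \<in> carrier_mat n k"
  shows "map_mat Re (mat_adjoint U * U) =
      transpose_mat (map_mat Re U) * map_mat Re U + transpose_mat (map_mat Im U) * map_mat Im U"
    and "map_mat Im (mat_adjoint U * U) =
      transpose_mat (map_mat Re U) * map_mat Im U - transpose_mat (map_mat Im U) * map_mat Re U"
proof -
  have dim: "dim_row (mat_adjoint U) = k" "dim_col (mat_adjoint U) = n"
    using assms by (auto simp: mat_adjoint_def)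
  have entry: "(mat_adjoint U * U) $$ (i, j) = (\<Sum>l = 0..<n. cnj (U $$ (l, i)) * U $$ (l, j))"
    if "i < k" "j < k" for i j
    using assms that dim by (simp add: scalar_prod_def mat_adjoint_def mat_of_rows_def)
  show "map_mat Re (mat_adjoint U * U) =
      transpose_mat (map_mat Re U) * map_mat Re U + transpose_mat (map_mat Im U) * map_mat Im U"
    using assms dim
    by (intro eq_matI) (auto simp del: index_mult_mat(1) simp: entry,
      auto simp: scalar_prod_def sum.distrib)
  show "map_mat Im (mat_adjoint U * U) =
      transpose_mat (map_mat Re U) * map_mat Im U - transpose_mat (map_mat Im U) * map_mat Re U"
    using assms dim
    by (intro eq_matI) (auto simp del: index_mult_mat(1) simp: entry,
      auto simp: scalar_prod_def sum_subtractf)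
qed

lemma complex_svd_conditions:
  assumes "complex_svd n k X U"
  shows "U \<in> carrier_mat n k"
    and "transpose_mat (map_mat Re U) * map_mat Re U + transpose_mat (map_mat Im U) * map_mat Im U = 1\<^sub>m k"
    and "transpose_mat (map_mat Re U) * map_mat Im U = transpose_mat (map_mat Im U) * map_mat Re U"
proof -
  have U: "U \<in> carrier_mat n k" and one: "mat_adjoint U * U = 1\<^sub>m k"
    using assms by (auto simp: complex_svd_def is_arg_min_def)
  have "map_mat Re (1\<^sub>m k) = 1\<^sub>m k" "map_mat Im (1\<^sub>m k) = 0\<^sub>m k k"
    by (auto intro!: eq_matI simp: one_mat_def)
  note parts = mat_adjoint_mult_self[OF U, unfolded one this]
  show "U \<in> carrier_mat n k" by (rule U)
  show "transpose_mat (map_mat Re U) * map_mat Re U + transpose_mat (map_mat Im U) * map_mat Im U = 1\<^sub>m k"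
    using parts(1) by simp
  show "transpose_mat (map_mat Re U) * map_mat Im U = transpose_mat (map_mat Im U) * map_mat Re U"
    using parts(2) U by (subst minus_mat_eq_zero_iff[symmetric, of _ k k]) auto
qed

lemma complex_svd_symplectic_orthonormal:
  assumes "complex_svd n k X U"
  shows "symplectic_orthonormal n k (complex_svd_basis n U)"
  unfolding complex_svd_basis_def using complex_svd_conditions[OF assms]
  by (intro symplectic_orthonormal_append_rows) simp_all

section \<open>The greedy procedure\<close>

text \<open>
  Under the identification of \<open>(q, p)\<close> with \<open>q + i p\<close>, the number \<open>u \<bullet> v + i (u \<bullet> J v)\<close> is the Hermitian
  inner product of \<open>u\<close> and \<open>v\<close>, conjugate-linear in \<open>u\<close>. The list is orthonormal for that product.
  Stated for vectors, the condition can be checked one greedy step at a time.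
\<close>

definition hermitian_orthonormal :: "nat \<Rightarrow> real vec list \<Rightarrow> bool" where
  "hermitian_orthonormal n es \<longleftrightarrow> set es \<subseteq> carrier_vec (2 * n) \<and>
    (\<forall>i < length es. \<forall>j < length es.
      es ! i \<bullet> es ! j = (if i = j then 1 else 0) \<and> es ! i \<bullet> (poisson n *\<^sub>v es ! j) = 0)"

lemma scalar_prod_poisson_skew:
  assumes "u \<in> carrier_vec (2 * n)" "v \<in> carrier_vec (2 * n)"
  shows "u \<bullet> (poisson n *\<^sub>v v) = - (v \<bullet> (poisson n *\<^sub>v u))"
proof -
  have Ju: "poisson n *\<^sub>v u \<in> carrier_vec (2 * n)"
    by (rule mult_mat_vec_carrier[OF poisson_carrier assms(1)])
  have "u \<bullet> (poisson n *\<^sub>v v) = (transpose_mat (poisson n) *\<^sub>v u) \<bullet> v"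
    using assms by (simp add: transpose_vec_mult_scalar[of _ "2 * n" "2 * n"])
  also have "transpose_mat (poisson n) *\<^sub>v u = - (poisson n *\<^sub>v u)"
    using assms by (simp add: transpose_poisson)
  also have "\<dots> \<bullet> v = - ((poisson n *\<^sub>v u) \<bullet> v)"
    using assms Ju by simp
  also have "(poisson n *\<^sub>v u) \<bullet> v = v \<bullet> (poisson n *\<^sub>v u)"
    using assms Ju by (intro comm_scalar_prod)
  finally show ?thesis .
qed

lemma scalar_prod_poisson_self:
  assumes "u \<in> carrier_vec (2 * n)"
  shows "u \<bullet> (poisson n *\<^sub>v u) = 0"
  using scalar_prod_poisson_skew[OF assms assms] by simp

lemma greedy_basis_eq_poisson_extension:
  assumes "set es \<subseteq> carrier_vec (2 * n)"
  shows "greedy_basis n es = poisson_extension n (mat_of_cols (2 * n) es)"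
proof (rule eq_matI)
  let ?E = "mat_of_cols (2 * n) es" and ?JT = "transpose_mat (poisson n)"
  have JTE: "?JT * ?E \<in> carrier_mat (2 * n) (length es)" by (auto intro: mult_carrier_mat)
  show "dim_row (greedy_basis n es) = dim_row (poisson_extension n ?E)"
    "dim_col (greedy_basis n es) = dim_col (poisson_extension n ?E)"
    by (auto simp: greedy_basis_def poisson_extension_def append_cols_def)
  fix i j assume "i < dim_row (poisson_extension n ?E)" "j < dim_col (poisson_extension n ?E)"
  then have ij: "i < 2 * n" "j < length es + length es"
    by (auto simp: poisson_extension_def append_cols_def)
  show "greedy_basis n es $$ (i, j) = poisson_extension n ?E $$ (i, j)"
  proof (cases "j < length es")
    case True
    then show ?thesis
      using ij by (simp add: greedy_basis_def poisson_extension_def append_cols_def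
        mat_of_cols_index nth_append)
  next
    case False
    then have j: "j - length es < length es" using ij by simp
    then have "col ?E (j - length es) = es ! (j - length es)"
      using assms by (intro col_mat_of_cols) (auto dest: nth_mem)
    then show ?thesis
      using ij False j by (simp add: greedy_basis_def poisson_extension_def append_cols_def
        mat_of_cols_index nth_append)
  qed
qed

lemma symplectic_orthonormal_greedy_basis_iff:
  assumes es: "set es \<subseteq> carrier_vec (2 * n)"
  shows "symplectic_orthonormal n (length es) (greedy_basis n es) \<longleftrightarrow> hermitian_orthonormal n es"
proof -
  let ?E = "mat_of_cols (2 * n) es" and ?k = "length es"
  have E: "?E \<in> carrier_mat (2 * n) ?k" by simp
  have c: "es ! i \<in> carrier_vec (2 * n)" if "i < ?k" for i using es that nth_mem by blast
  have col: "col ?E i = es ! i" if "i < ?k" for i using c that by (intro col_mat_of_cols)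
  have gram: "(transpose_mat ?E * ?E) $$ (i, j) = es ! i \<bullet> es ! j" if "i < ?k" "j < ?k" for i j
    using that by (simp add: col)
  have "transpose_mat ?E * poisson n * ?E = transpose_mat ?E * (poisson n * ?E)"
    by (intro assoc_mult_mat[of _ ?k "2 * n" _ "2 * n" _ ?k]) auto
  moreover have "col (poisson n * ?E) j = poisson n *\<^sub>v es ! j" if "j < ?k" for j
    using that col[OF that] col_mult2[OF poisson_carrier E, of j] by simp
  ultimately have form: "(transpose_mat ?E * poisson n * ?E) $$ (i, j) = es ! i \<bullet> (poisson n *\<^sub>v es ! j)"
    if "i < ?k" "j < ?k" for i j
    using that by (simp add: col del: col_mult2)
  have eq_iff: "A = B \<longleftrightarrow> (\<forall>i < ?k. \<forall>j < ?k. A $$ (i, j) = B $$ (i, j))"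
    if "A \<in> carrier_mat ?k ?k" "B \<in> carrier_mat ?k ?k" for A B :: "real mat"
    using that by (auto intro!: eq_matI)
  have "transpose_mat ?E * ?E = 1\<^sub>m ?k \<longleftrightarrow>
      (\<forall>i < ?k. \<forall>j < ?k. es ! i \<bullet> es ! j = (if i = j then 1 else 0))"
    by (subst eq_iff) (auto intro!: mult_carrier_mat simp: gram simp del: index_mult_mat(1))
  moreover have "transpose_mat ?E * poisson n * ?E = 0\<^sub>m ?k ?k \<longleftrightarrow>
      (\<forall>i < ?k. \<forall>j < ?k. es ! i \<bullet> (poisson n *\<^sub>v es ! j) = 0)"
    by (subst eq_iff) (auto intro!: mult_carrier_mat simp: form simp del: index_mult_mat(1))
  ultimately show ?thesis
    unfolding greedy_basis_eq_poisson_extension[OF es] symplectic_orthonormal_poisson_extension_iff[OF E]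
      hermitian_orthonormal_def using es by blast
qed

text \<open>
  The skew symmetry of \<open>J\<close> yields the conditions with \<open>e\<close> on the left, and \<open>e \<bullet> J e = 0\<close>.
\<close>

lemma hermitian_orthonormal_snoc:
  assumes es: "hermitian_orthonormal n es" and e: "e \<in> carrier_vec (2 * n)" "e \<bullet> e = 1"
    and orth: "\<And>u. u \<in> set es \<Longrightarrow> u \<bullet> e = 0" "\<And>u. u \<in> set es \<Longrightarrow> u \<bullet> (poisson n *\<^sub>v e) = 0"
  shows "hermitian_orthonormal n (es @ [e])"
proof -
  have c: "es ! i \<in> carrier_vec (2 * n)" if "i < length es" for i
    using es that nth_mem unfolding hermitian_orthonormal_def by blast
  have "e \<bullet> es ! i = 0" if "i < length es" for i
    using orth(1)[OF nth_mem[OF that]] comm_scalar_prod[OF e(1) c[OF that]] by simp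
  moreover have "e \<bullet> (poisson n *\<^sub>v es ! i) = 0" if "i < length es" for i
    using orth(2)[OF nth_mem[OF that]] scalar_prod_poisson_skew[OF e(1) c[OF that]] by simp
  ultimately show ?thesis
    using es e orth scalar_prod_poisson_self[OF e(1)]
    unfolding hermitian_orthonormal_def by (auto simp: nth_append less_Suc_eq)
qed

text \<open>
  With \<open>V\<^sup>+ = V\<^sup>T\<close> and \<open>V\<^sup>T V = I\<close>, the residual satisfies \<open>V\<^sup>T (x - V V\<^sup>+ x) = V\<^sup>T x - V\<^sup>T x = 0\<close>.
\<close>

lemma transpose_mult_residual:
  assumes V: "symplectic_orthonormal n k V" and x: "x \<in> carrier_vec (2 * n)"
  shows "transpose_mat V *\<^sub>v (x - V *\<^sub>v (symplectic_inverse n k V *\<^sub>v x)) = 0\<^sub>v (2 * k)"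
proof -
  have Vc: "V \<in> carrier_mat (2 * n) (2 * k)" and gram: "transpose_mat V * V = 1\<^sub>m (2 * k)"
    using V by (auto simp: symplectic_orthonormal_def symplectic_def orthonormal_columns_def)
  let ?y = "transpose_mat V *\<^sub>v x"
  have y: "?y \<in> carrier_vec (2 * k)" using Vc x by (intro mult_mat_vec_carrier[of _ _ "2 * n"]) auto
  have Vy: "V *\<^sub>v ?y \<in> carrier_vec (2 * n)" by (rule mult_mat_vec_carrier[OF Vc y])
  have "transpose_mat V *\<^sub>v (x - V *\<^sub>v ?y) = ?y - transpose_mat V *\<^sub>v (V *\<^sub>v ?y)"
    using Vc x Vy by (intro mult_minus_distrib_mat_vec) auto
  also have "transpose_mat V *\<^sub>v (V *\<^sub>v ?y) = transpose_mat V * V *\<^sub>v ?y"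
    using Vc y by (intro assoc_mult_mat_vec[symmetric]) auto
  finally show ?thesis
    unfolding symplectic_inverse_eq_transpose[OF V] gram using y by simp
qed

lemma scalar_prod_self_pos:
  fixes z :: "real vec"
  assumes "z \<in> carrier_vec m" "z \<noteq> 0\<^sub>v m"
  shows "0 < z \<bullet> z"
proof -
  have "z \<bullet> z \<noteq> 0"
  proof
    assume "z \<bullet> z = 0"
    then have "\<forall>i \<in> {0..<m}. z $ i * z $ i = 0"
      using assms(1) by (subst (asm) scalar_prod_def, subst (asm) sum_nonneg_eq_0_iff) auto
    then have "z = 0\<^sub>v m" using assms(1) by (intro eq_vecI) auto
    with assms(2) show False by simp
  qed
  moreover have "0 \<le> z \<bullet> z" unfolding scalar_prod_def by (intro sum_nonneg) simp
  ultimately show ?thesis by simp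
qed

text \<open>
  Inductively \<open>V\<close> is symplectic with orthonormal columns, so the residual \<open>z\<close> is orthogonal to all
  columns \<open>e\<^sub>i\<close> and \<open>J\<^sup>T e\<^sub>i\<close> of \<open>V\<close>. The second half of these relations reads \<open>e\<^sub>i \<bullet> J z = 0\<close>, which is
  what makes the enlarged list orthonormal also in the Hermitian sense.
\<close>

lemma greedy_hermitian_orthonormal:
  assumes "greedy n X es" "dim_row X = 2 * n"
  shows "hermitian_orthonormal n es"
  using assms
proof (induction rule: greedy.induct)
  case (init e)
  then show ?case by (simp add: hermitian_orthonormal_def scalar_prod_poisson_self)
next
  case (extend es x V z)
  then have herm: "hermitian_orthonormal n es" by blast
  then have es: "set es \<subseteq> carrier_vec (2 * n)" by (simp add: hermitian_orthonormal_def)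
  let ?k = "length es" and ?J = "poisson n"
  have V: "symplectic_orthonormal n ?k V"
    using herm symplectic_orthonormal_greedy_basis_iff[OF es] extend.hyps(3) by blast
  then have Vc: "V \<in> carrier_mat (2 * n) (2 * ?k)"
    by (simp add: symplectic_orthonormal_def symplectic_def)
  have x: "x \<in> carrier_vec (2 * n)" using extend.hyps(2) extend.prems cols_dim[of X] by auto
  have z: "z \<in> carrier_vec (2 * n)"
    unfolding extend.hyps(4) symplectic_inverse_eq_transpose[OF V] using x Vc
    by (intro minus_carrier_vec mult_mat_vec_carrier[OF Vc] mult_mat_vec_carrier[of _ _ "2 * n"]) auto
  have Vz: "transpose_mat V *\<^sub>v z = 0\<^sub>v (2 * ?k)"
    using transpose_mult_residual[OF V x] extend.hyps(4) by simp
  have colz: "col V j \<bullet> z = 0" if "j < 2 * ?k" for j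
  proof -
    have "col V j \<bullet> z = (transpose_mat V *\<^sub>v z) $ j" using that Vc by simp
    then show ?thesis using that Vz by simp
  qed
  have orth: "es ! i \<bullet> z = 0" "es ! i \<bullet> (?J *\<^sub>v z) = 0" if i: "i < ?k" for i
  proof -
    have ei: "es ! i \<in> carrier_vec (2 * n)" using es i nth_mem by blast
    have JTei: "transpose_mat ?J *\<^sub>v es ! i \<in> carrier_vec (2 * n)"
      using ei by (intro mult_mat_vec_carrier[of _ _ "2 * n"]) auto
    have "col V i = es ! i" "col V (?k + i) = transpose_mat ?J *\<^sub>v es ! i"
      using i ei JTei unfolding extend.hyps(3) greedy_basis_def
      by (subst col_mat_of_cols; simp add: nth_append)+
    then show "es ! i \<bullet> z = 0" "es ! i \<bullet> (?J *\<^sub>v z) = 0"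
      using colz[of i] colz[of "?k + i"] i transpose_vec_mult_scalar[OF poisson_carrier z ei] by auto
  qed
  have pos: "0 < z \<bullet> z" using scalar_prod_self_pos[OF z] extend.hyps(5) by blast
  define c where "c = 1 / sqrt (z \<bullet> z)"
  have Jz: "?J *\<^sub>v z \<in> carrier_vec (2 * n)" by (rule mult_mat_vec_carrier[OF poisson_carrier z])
  have "(c \<cdot>\<^sub>v z) \<bullet> (c \<cdot>\<^sub>v z) = c * c * (z \<bullet> z)" using z by simp
  also have "\<dots> = 1" using pos by (simp add: c_def field_simps)
  finally have unit: "(c \<cdot>\<^sub>v z) \<bullet> (c \<cdot>\<^sub>v z) = 1" .
  show ?case
    unfolding c_def[symmetric]
  proof (rule hermitian_orthonormal_snoc[OF herm _ unit])
    show "c \<cdot>\<^sub>v z \<in> carrier_vec (2 * n)" using z by simp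
    fix u assume "u \<in> set es"
    then obtain i where i: "i < ?k" "u = es ! i" by (auto simp: in_set_conv_nth)
    then have u: "u \<in> carrier_vec (2 * n)" using es nth_mem by blast
    show "u \<bullet> (c \<cdot>\<^sub>v z) = 0" using orth(1)[OF i(1)] i(2) u z by simp
    have "?J *\<^sub>v (c \<cdot>\<^sub>v z) = c \<cdot>\<^sub>v (?J *\<^sub>v z)" using z by (intro mult_mat_vec) auto
    then show "u \<bullet> (?J *\<^sub>v (c \<cdot>\<^sub>v z)) = 0" using orth(2)[OF i(1)] i(2) u Jz by simp
  qed
qed

section \<open>The non-linear programming procedure\<close>

lemma ct_or_csvd_basis_symplectic_orthonormal:
  assumes "k \<le> n" "ct_or_csvd_basis n k X V"
  shows "symplectic_orthonormal n k V"
proof -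
  consider \<Phi> where "cotangent_lift n k X \<Phi>" "V = cotangent_lift_basis n k \<Phi>"
    | U where "complex_svd n k X U" "V = complex_svd_basis n U"
    using assms(2) unfolding ct_or_csvd_basis_def by blast
  then show ?thesis
  proof cases
    case 1
    then show ?thesis using cotangent_lift_symplectic_orthonormal assms(1) by blast
  next
    case 2
    then show ?thesis using complex_svd_symplectic_orthonormal by blast
  qed
qed

text \<open>
  For a symplectic matrix, orthonormal columns and commutation with \<open>J\<close> imply each other, and
  commutation is the block shape.
\<close>

lemma orthonormal_iff_poisson_extension_of_symplectic:
  assumes "symplectic k r C"
  shows "orthonormal_columns C \<longleftrightarrow> (\<exists>G \<in> carrier_mat (2 * k) r. C = poisson_extension k G)"
proof -
  have C: "C \<in> carrier_mat (2 * k) (2 * r)" using assms by (simp add: symplectic_def)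
  have "orthonormal_columns C \<longleftrightarrow> poisson k * C = C * poisson r"
    using symplectic_orthonormal_commutes[of k r C] symplectic_iff_orthonormal_of_commutes[OF C] assms
    unfolding symplectic_orthonormal_def by blast
  then show ?thesis using poisson_extension_iff_commutes[OF C] by blast
qed

theorem proposition5:
  fixes n k ns :: nat and X :: "real mat"
  assumes "k \<le> n" and "X \<in> carrier_mat (2 * n) ns"
  shows
    "(\<forall>\<Phi>. cotangent_lift n k X \<Phi> \<longrightarrow>
        \<Phi> \<in> carrier_mat n k \<and>
        transpose_mat \<Phi> * \<Phi> = 1\<^sub>m k \<and>
        cotangent_lift_basis n k \<Phi> = poisson_extension n (\<Phi> @\<^sub>r 0\<^sub>m n k) \<and>
        symplectic_orthonormal n k (cotangent_lift_basis n k \<Phi>))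
   \<and> (\<forall>U \<Phi> \<Psi>. complex_svd n k X U \<longrightarrow> \<Phi> = map_mat Re U \<longrightarrow> \<Psi> = map_mat Im U \<longrightarrow>
        \<Phi> \<in> carrier_mat n k \<and> \<Psi> \<in> carrier_mat n k \<and>
        transpose_mat \<Phi> * \<Phi> + transpose_mat \<Psi> * \<Psi> = 1\<^sub>m k \<and>
        transpose_mat \<Phi> * \<Psi> = transpose_mat \<Psi> * \<Phi> \<and>
        complex_svd_basis n U = poisson_extension n (\<Phi> @\<^sub>r \<Psi>) \<and>
        symplectic_orthonormal n k (complex_svd_basis n U))
   \<and> (\<forall>\<Phi> E. \<Phi> \<in> carrier_mat n k \<longrightarrow> E = \<Phi> @\<^sub>r 0\<^sub>m n k \<longrightarrow>
        (transpose_mat \<Phi> * \<Phi> = 1\<^sub>m k \<longleftrightarrow>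
         transpose_mat E * E = 1\<^sub>m k \<and> transpose_mat E * poisson n * E = 0\<^sub>m k k))
   \<and> (\<forall>\<Phi> \<Psi> E. \<Phi> \<in> carrier_mat n k \<longrightarrow> \<Psi> \<in> carrier_mat n k \<longrightarrow> E = \<Phi> @\<^sub>r \<Psi> \<longrightarrow>
        (transpose_mat \<Phi> * \<Phi> + transpose_mat \<Psi> * \<Psi> = 1\<^sub>m k \<and>
         transpose_mat \<Phi> * \<Psi> = transpose_mat \<Psi> * \<Phi> \<longleftrightarrow>
         transpose_mat E * E = 1\<^sub>m k \<and> transpose_mat E * poisson n * E = 0\<^sub>m k k))
   \<and> (\<forall>es. greedy n X es \<longrightarrow> length es = k \<longrightarrow>
        set es \<subseteq> carrier_vec (2 * n) \<and>
        greedy_basis n es = poisson_extension n (mat_of_cols (2 * n) es) \<and>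
        symplectic_orthonormal n k (greedy_basis n es))
   \<and> (\<forall>r V C W. nlp n k r X V C W \<longrightarrow>
        (orthonormal_columns C \<longleftrightarrow> (\<exists>G \<in> carrier_mat (2 * k) r. C = poisson_extension k G)) \<and>
        (orthonormal_columns C \<longrightarrow> symplectic_orthonormal n r W) \<and>
        (\<forall>G \<in> carrier_mat (2 * k) r. C = poisson_extension k G \<longrightarrow>
           W = poisson_extension n (V * G) \<and> symplectic_orthonormal n r W))"
proof (intro conjI allI impI ballI)
  show "\<Phi> \<in> carrier_mat n k" "transpose_mat \<Phi> * \<Phi> = 1\<^sub>m k"
    "cotangent_lift_basis n k \<Phi> = poisson_extension n (\<Phi> @\<^sub>r 0\<^sub>m n k)"
    "symplectic_orthonormal n k (cotangent_lift_basis n k \<Phi>)"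
    if "cotangent_lift n k X \<Phi>" for \<Phi>
    using cotangent_lift_orthonormal[OF assms(1) that] cotangent_lift_symplectic_orthonormal[OF assms(1) that]
      cotangent_lift_basis_eq_poisson_extension by blast+
next
  fix U \<Phi> \<Psi> assume U: "complex_svd n k X U" and \<Phi>\<Psi>: "\<Phi> = map_mat Re U" "\<Psi> = map_mat Im U"
  show "\<Phi> \<in> carrier_mat n k" "\<Psi> \<in> carrier_mat n k"
    unfolding \<Phi>\<Psi> using complex_svd_conditions(1)[OF U] by simp_all
  show "transpose_mat \<Phi> * \<Phi> + transpose_mat \<Psi> * \<Psi> = 1\<^sub>m k"
    "transpose_mat \<Phi> * \<Psi> = transpose_mat \<Psi> * \<Phi>"
    unfolding \<Phi>\<Psi> by (fact complex_svd_conditions[OF U])+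
  show "complex_svd_basis n U = poisson_extension n (\<Phi> @\<^sub>r \<Psi>)"
    unfolding \<Phi>\<Psi> by (rule complex_svd_basis_def)
  show "symplectic_orthonormal n k (complex_svd_basis n U)"
    by (rule complex_svd_symplectic_orthonormal[OF U])
next
  show "transpose_mat \<Phi> * \<Phi> = 1\<^sub>m k \<longleftrightarrow>
      transpose_mat E * E = 1\<^sub>m k \<and> transpose_mat E * poisson n * E = 0\<^sub>m k k"
    if "\<Phi> \<in> carrier_mat n k" "E = \<Phi> @\<^sub>r 0\<^sub>m n k" for \<Phi> E
    using append_rows_conditions_iff[of \<Phi> n k "0\<^sub>m n k" E] that by simp
next
  show "transpose_mat \<Phi> * \<Phi> + transpose_mat \<Psi> * \<Psi> = 1\<^sub>m k \<and>
        transpose_mat \<Phi> * \<Psi> = transpose_mat \<Psi> * \<Phi> \<longleftrightarrow>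
      transpose_mat E * E = 1\<^sub>m k \<and> transpose_mat E * poisson n * E = 0\<^sub>m k k"
    if "\<Phi> \<in> carrier_mat n k" "\<Psi> \<in> carrier_mat n k" "E = \<Phi> @\<^sub>r \<Psi>" for \<Phi> \<Psi> E
    using that by (rule append_rows_conditions_iff)
next
  fix es assume greedy: "greedy n X es" and len: "length es = k"
  have herm: "hermitian_orthonormal n es"
    using greedy_hermitian_orthonormal[OF greedy] assms(2) by simp
  then show es: "set es \<subseteq> carrier_vec (2 * n)" by (simp add: hermitian_orthonormal_def)
  show "greedy_basis n es = poisson_extension n (mat_of_cols (2 * n) es)"
    by (rule greedy_basis_eq_poisson_extension[OF es])
  show "symplectic_orthonormal n k (greedy_basis n es)"
    using symplectic_orthonormal_greedy_basis_iff[OF es] herm len by blast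
next
  fix r V C W assume "nlp n k r X V C W"
  then have V: "symplectic_orthonormal n k V" and C: "symplectic k r C" and W: "W = V * C"
    using ct_or_csvd_basis_symplectic_orthonormal[OF assms(1)] unfolding nlp_def by blast+
  show iff: "orthonormal_columns C \<longleftrightarrow> (\<exists>G \<in> carrier_mat (2 * k) r. C = poisson_extension k G)"
    by (rule orthonormal_iff_poisson_extension_of_symplectic[OF C])
  show orth: "symplectic_orthonormal n r W" if "orthonormal_columns C"
    unfolding W using symplectic_orthonormal_mult[OF V] C that
    by (simp add: symplectic_orthonormal_def)
  fix G assume G: "G \<in> carrier_mat (2 * k) r" "C = poisson_extension k G"
  have "V \<in> carrier_mat (2 * n) (2 * k)"
    using V by (simp add: symplectic_orthonormal_def symplectic_def)
  then show "W = poisson_extension n (V * G)"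
    unfolding W G(2) using symplectic_orthonormal_commutes[OF V] G(1) by (rule mult_poisson_extension)
  show "symplectic_orthonormal n r W" using orth iff G by blast
qed

end
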